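(* Let $r\equiv5\pmod6$ with $r\ge11$. Let $T$ be a directed rotational terrace of $\mathbb Z_r$ containing the path $9\to6\to7\to5\to8\to3\to10$, let $j\in\mathbb Z_3$, and suppose the output $H$ of the fixed-port construction from $T$ at residue $j$ is a $3$-layer balanced Hamilton starter of $\mathcal C_3(r)$. Then $H$ is chain-compatible, and $0\to2\to4\to\cdots\to2r$ is a compatible deletion chain for $H$.
   Context: Let $[r]=\{1,\ldots,r\}$. $\mathcal C_3(r)$ is the directed Cayley digraph on $\mathbb Z_{3r}$ with arcs $x\to x+s$, $x\in\mathbb Z_{3r}$, $s\in[r]$; the arc $x\to x+s$ has tail $x$ and step $s$. A $3$-layer balanced Hamilton starter is a directed Hamilton cycle of $\mathcal C_3(r)$ containing, for every $(j,s)\in\mathbb Z_3\times[r]$, exactly one arc of step $s$ with tail congruent to $j$ mod $3$. For such $H$ put $H_k=H+3k$ ($k\in\mathbb Z_r$), the image of $H$ under $x\mapsto x+3k$; these partition the arc set. A compatible deletion chain for $H$ is a simple directed path of length $r$ (with $r+1$ distinct vertices) containing exactly one arc from each $H_k$; $H$ is chain-compatible if such a path exists. A directed rotational terrace of $\mathbb Z_r$ is a cyclic ordering $T=(t_0,\ldots,t_{r-2})$ of $\mathbb Z_r\setminus\{0\}$ such that the cyclic differences $d_i=[t_{i+1}-t_i]_r$ ($i\in\mathbb Z_{r-1}$) run through $1,\ldots,r-1$ exactly once, where $[x]_r\in\{1,\ldots,r-1\}$ is the representative of a nonzero $x\in\mathbb Z_r$. $T$ contains a directed path if the vertex sequence of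 the path occurs consecutively, in the displayed order, in the cyclic ordering $T$. Lift: $F_3(T)$ is the spanning subdigraph of $\mathcal C_3(r)$ in which each vertex has exactly one outgoing arc: for $0\le \ell<3$, the vertex $t_i+\ell r$ (with $t_i$ represented in $\{1,\ldots,r-1\}$) has outgoing arc of step $d_i$, and the vertex $\ell r$ has outgoing arc of step $r$. Fixed-port construction at residue $j$: for $x\in\mathbb Z_r$ let $\widetilde x_j\in\mathbb Z_{3r}$ be the unique element congruent to $x$ mod $r$ and to $j$ mod $3$. In $F_3(T)$ the outgoing steps at the tails $\widetilde 9_j,\widetilde 6_j,\widetilde 3_j,\widetilde 0_j$ are $r-3,1,7,r$ respectively; replace them by $1,r,r-3,7$ respectively, leaving all other outgoing arcs unchanged. The resulting spanning subdigraph is the output. *)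

theory Defs
  imports "Graph_Theory.Graph_Theory" "HOL-Number_Theory.Cong"
begin

text \<open>
  Elements of \<open>\<int>\<^sub>n\<close> are represented by the integers \<open>0, \<dots>, n - 1\<close>. An arc of
  \<open>C\<^sub>3(r)\<close> is the pair \<open>(x, s)\<close> of its tail and its step.
\<close>

definition C3 :: "nat \<Rightarrow> (int, int \<times> int) pre_digraph" where
  "C3 r = \<lparr> verts = {0..<3 * int r},
            arcs = {0..<3 * int r} \<times> {1..int r},
            tail = fst,
            head = (\<lambda>(x, s). (x + s) mod (3 * int r)) \<rparr>"

abbreviation step :: "int \<times> int \<Rightarrow> int" where
  "step \<equiv> snd"

definition hamilton_cycle :: "('a, 'b) pre_digraph \<Rightarrow> ('a, 'b) pre_digraph \<Rightarrow> bool" where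
  "hamilton_cycle G H \<longleftrightarrow> spanning H G \<and>
     (\<exists>p. pre_digraph.cycle H p \<and> set p = arcs H \<and> tail H ` set p = verts G)"

definition balanced_hamilton_starter :: "nat \<Rightarrow> (int, int \<times> int) pre_digraph \<Rightarrow> bool" where
  "balanced_hamilton_starter r H \<longleftrightarrow> hamilton_cycle (C3 r) H \<and>
     (\<forall>j\<in>{0..<3}. \<forall>s\<in>{1..int r}. \<exists>!a. a \<in> arcs H \<and> step a = s \<and> tail H a mod 3 = j)"

definition translate :: "nat \<Rightarrow> (int, int \<times> int) pre_digraph \<Rightarrow> int \<Rightarrow> (int, int \<times> int) pre_digraph" where
  "translate r H c = H\<lparr> verts := (\<lambda>x. (x + c) mod (3 * int r)) ` verts H,
                        arcs := (\<lambda>(x, s). ((x + c) mod (3 * int r), s)) ` arcs H \<rparr>"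

text \<open>A chain is given by its list of arcs; \<open>apath\<close> requires all its vertices, including the last one,
  to be distinct.\<close>

definition compatible_deletion_chain ::
  "nat \<Rightarrow> (int, int \<times> int) pre_digraph \<Rightarrow> (int \<times> int) list \<Rightarrow> bool" where
  "compatible_deletion_chain r H p \<longleftrightarrow>
     (\<exists>u v. pre_digraph.apath (C3 r) u p v) \<and> length p = r \<and>
     (\<forall>k\<in>{0..<int r}. \<exists>!a. a \<in> set p \<and> a \<in> arcs (translate r H (3 * k)))"

definition chain_compatible :: "nat \<Rightarrow> (int, int \<times> int) pre_digraph \<Rightarrow> bool" where
  "chain_compatible r H \<longleftrightarrow> (\<exists>p. compatible_deletion_chain r H p)"

text \<open>A cyclic ordering is given by a list listing it from an arbitrary starting point.\<close>

definition cyclic_diff :: "nat \<Rightarrow> int list \<Rightarrow> nat \<Rightarrow> int" where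
  "cyclic_diff r T i = (T ! (Suc i mod length T) - T ! i) mod int r"

definition directed_rotational_terrace :: "nat \<Rightarrow> int list \<Rightarrow> bool" where
  "directed_rotational_terrace r T \<longleftrightarrow>
     distinct T \<and> set T = {1..<int r} \<and>
     bij_betw (cyclic_diff r T) {0..<length T} {1..<int r}"

definition cyclically_contains :: "'a list \<Rightarrow> 'a list \<Rightarrow> bool" where
  "cyclically_contains T p \<longleftrightarrow>
     (\<exists>i<length T. \<forall>k<length p. T ! ((i + k) mod length T) = p ! k)"

definition F3 :: "nat \<Rightarrow> int list \<Rightarrow> (int, int \<times> int) pre_digraph" where
  "F3 r T = (C3 r)\<lparr> arcs :=
     {(T ! i + l * int r, cyclic_diff r T i) | i l. i < length T \<and> l \<in> {0..<3}} \<union>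
     {(l * int r, int r) | l. l \<in> {0..<3}} \<rparr>"

text \<open>Well-defined when \<open>r\<close> is coprime to 3.\<close>

definition crt_lift :: "nat \<Rightarrow> int \<Rightarrow> int \<Rightarrow> int" where
  "crt_lift r j x = (THE y. y \<in> {0..<3 * int r} \<and> [y = x] (mod int r) \<and> [y = j] (mod 3))"

definition fixed_port :: "nat \<Rightarrow> int list \<Rightarrow> int \<Rightarrow> (int, int \<times> int) pre_digraph" where
  "fixed_port r T j = (F3 r T)\<lparr> arcs :=
     {a \<in> arcs (F3 r T). tail (F3 r T) a \<notin> crt_lift r j ` {9, 6, 3, 0}} \<union>
     {(crt_lift r j 9, 1), (crt_lift r j 6, int r),
      (crt_lift r j 3, int r - 3), (crt_lift r j 0, 7)} \<rparr>"

text \<open>The path \<open>0 \<rightarrow> 2 \<rightarrow> 4 \<rightarrow> \<dots> \<rightarrow> 2r\<close>.\<close>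

definition even_path :: "nat \<Rightarrow> (int \<times> int) list" where
  "even_path r = map (\<lambda>i. (2 * int i, 2)) [0..<r]"

lemma awalk_verts_even_path:
  assumes "r > 0"
  shows "pre_digraph.awalk_verts (C3 r) 0 (even_path r) = map (\<lambda>i. 2 * int i) [0..<Suc r]"
proof -
  interpret pre_digraph "C3 r" .
  have C3_sel: "tail (C3 r) = fst" "head (C3 r) = (\<lambda>(x, s). (x + s) mod (3 * int r))"
    by (simp_all add: C3_def)
  have "awalk_verts (2 * int m) (map (\<lambda>i. (2 * int i, 2)) [m..<n]) = map (\<lambda>i. 2 * int i) [m..<Suc n]"
    if "m \<le> n" "n \<le> r" for m n
    using that
  proof (induction "n - m" arbitrary: m)
    case 0
    then show ?case by simp
  next
    case (Suc d)
    then have "m < n" by simp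
    with Suc.prems assms have "(2 * int m + 2) mod (3 * int r) = 2 * int (Suc m)"
      by (cases "r = 1") auto
    moreover have "awalk_verts (2 * int (Suc m)) (map (\<lambda>i. (2 * int i, 2)) [Suc m..<n])
        = map (\<lambda>i. 2 * int i) [Suc m..<Suc n]"
      using Suc.hyps(1)[of "Suc m"] Suc.hyps(2) Suc.prems \<open>m < n\<close> by simp
    ultimately show ?case
      using \<open>m < n\<close> Suc.prems C3_sel by (simp add: upt_conv_Cons add.commute del: upt_Suc)
  qed
  from this[of 0 r] show ?thesis by (simp add: even_path_def del: upt_Suc)
qed

end

theory Submission
  imports Defs
begin

text \<open>
  The deleted and inserted arcs have steps \<open>1, 7, r - 3, r\<close>, so the fixed-port construction leaves the
  three step-2 arcs of the lift in place. They come from a single arc \<open>t \<rightarrow> t + 2\<close> of the terrace, and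
  their tails are exactly the residues mod \<open>3r\<close> congruent to \<open>t\<close> mod \<open>r\<close>. Hence the arc
  \<open>2i \<rightarrow> 2i + 2\<close> lies in \<open>H + 3k\<close> iff \<open>2i \<equiv> t + 3k\<close> mod \<open>r\<close>, which for odd \<open>r\<close> has exactly one
  solution \<open>0 \<le> i < r\<close>.
\<close>

text \<open>\<open>crt_lift\<close> is a definite description, so nothing is known about it before
  the Chinese remainder theorem yields existence and uniqueness. Only the residue mod
  \<open>r\<close> is kept: it suffices to separate the modified tails from those of step 2.\<close>

lemma crt_lift_cong:
  assumes "coprime (int r) 3" "r > 0"
  shows "[crt_lift r j x = x] (mod int r)"
proof -
  obtain z where z: "[z = x] (mod int r)" "[z = j] (mod 3)"
    using binary_chinese_remainder_int[OF assms(1)] by blast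
  let ?P = "\<lambda>y. y \<in> {0..<3 * int r} \<and> [y = x] (mod int r) \<and> [y = j] (mod 3)"
  have "?P (z mod (3 * int r))"
    using z assms(2) by (auto simp: cong_def mod_mod_cancel)
  moreover have "y = y'" if "?P y" "?P y'" for y y'
  proof -
    have "[y = y'] (mod int r * 3)"
      using that by (intro coprime_cong_mult assms(1)) (auto simp: cong_def)
    then show ?thesis using that by (simp add: cong_def mult.commute)
  qed
  ultimately have "\<exists>!y. ?P y" by blast
  then have "?P (THE y. ?P y)" by (rule theI')
  then show ?thesis by (simp add: crt_lift_def)
qed

text \<open>Since the entries of \<open>T\<close> are distinct, \<open>p ! k\<close> has a single
  position in \<open>T\<close>, namely the one where the path passes through it; its successor in
  \<open>T\<close> can thus be read off from \<open>p\<close>.\<close>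

lemma cyclic_diff_contained:
  assumes "cyclically_contains T p" "distinct T" "i < length T"
    and "Suc k < length p" "T ! i = p ! k"
  shows "cyclic_diff r T i = (p ! Suc k - p ! k) mod int r"
proof -
  obtain m where m: "m < length T" "\<And>k. k < length p \<Longrightarrow> T ! ((m + k) mod length T) = p ! k"
    using assms(1) by (auto simp: cyclically_contains_def)
  have "T ! i = T ! ((m + k) mod length T)" using m(2)[of k] assms by simp
  moreover have "(m + k) mod length T < length T" using m(1) by (intro mod_less_divisor) auto
  ultimately have "i = (m + k) mod length T"
    using assms(2,3) by (simp add: nth_eq_iff_index_eq)
  then have "T ! (Suc i mod length T) = p ! Suc k"
    using m(2)[of "Suc k"] assms(4) by (simp add: mod_Suc_eq)
  then show ?thesis by (simp add: cyclic_diff_def assms(5))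
qed

lemma step2_arcs_F3:
  assumes T: "directed_rotational_terrace r T" and "r \<ge> 3"
  obtains t i where "t \<in> {1..<int r}" "t = T ! i" "i < length T" "cyclic_diff r T i = 2"
    "\<forall>x. (x, 2) \<in> arcs (F3 r T) \<longleftrightarrow> x \<in> {0..<3 * int r} \<and> [x = t] (mod int r)"
proof -
  have bij: "bij_betw (cyclic_diff r T) {0..<length T} {1..<int r}"
    and set: "set T = {1..<int r}"
    using T by (auto simp: directed_rotational_terrace_def)
  have "2 \<in> cyclic_diff r T ` {0..<length T}"
    using bij \<open>r \<ge> 3\<close> by (simp add: bij_betw_def)
  then obtain i where i: "i < length T" "cyclic_diff r T i = 2" by auto
  have uniq: "i' = i" if "i' < length T" "cyclic_diff r T i' = 2" for i'
    using bij that i by (auto simp: bij_betw_def inj_on_def)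
  define t where "t = T ! i"
  have t: "t \<in> {1..<int r}" using set i(1) nth_mem t_def by blast
  have "(x, 2) \<in> arcs (F3 r T) \<longleftrightarrow> x \<in> {0..<3 * int r} \<and> [x = t] (mod int r)" for x
  proof -
    have "(x, 2) \<in> arcs (F3 r T) \<longleftrightarrow>
        (\<exists>i' l. i' < length T \<and> l \<in> {0..<3} \<and> x = T ! i' + l * int r \<and> cyclic_diff r T i' = 2)"
      \<comment> \<open>The arcs at the vertices \<open>l * int r\<close> have step
        \<open>r\<close>, which differs from 2.\<close>
      using \<open>r \<ge> 3\<close> by (simp add: F3_def) metis
    also have "\<dots> \<longleftrightarrow> (\<exists>l\<in>{0..<3}. x = t + l * int r)"
      unfolding t_def using i uniq by blast
    also have "\<dots> \<longleftrightarrow> x \<in> {0..<3 * int r} \<and> [x = t] (mod int r)"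
    proof (intro iffI)
      assume "\<exists>l\<in>{0..<3}. x = t + l * int r"
      then obtain l where l: "0 \<le> l" "l \<le> 2" "x = t + l * int r" by auto
      have "l * int r \<le> 2 * int r" "0 \<le> l * int r"
        using mult_right_mono[OF l(2), of "int r"] l(1) by simp_all
      then have "x < 3 * int r" "0 \<le> x" using t unfolding l(3) atLeastLessThan_iff by linarith+
      then show "x \<in> {0..<3 * int r} \<and> [x = t] (mod int r)"
        using l(3) by (auto simp: cong_def)
    next
      assume x: "x \<in> {0..<3 * int r} \<and> [x = t] (mod int r)"
      \<comment> \<open>As \<open>0 < t < r\<close>, the remainder of \<open>x\<close> is
        \<open>t\<close> itself, and the layer \<open>l\<close> is the quotient.\<close>
      have "x mod int r = t" using x t by (simp add: cong_def)
      then have eq: "x = t + (x div int r) * int r" by (metis add.commute div_mult_mod_eq)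
      have "(x div int r) * int r < 3 * int r"
        using eq x t unfolding atLeastLessThan_iff by linarith
      then have "x div int r < 3" by (simp add: mult_less_cancel_right)
      moreover have "0 \<le> x div int r" using x \<open>r \<ge> 3\<close> by (simp add: pos_imp_zdiv_nonneg_iff)
      ultimately show "\<exists>l\<in>{0..<3}. x = t + l * int r"
        using eq by (intro bexI[of _ "x div int r"]) auto
    qed
    finally show ?thesis .
  qed
  then show thesis using t t_def i by (intro that) auto
qed

text \<open>No modified tail lies over \<open>t\<close>: the terrace leaves 9, 6 and 3 with
  differences other than 2, and 0 is not a terrace entry. So the description of the step-2 arcs of
  \<open>F3 r T\<close> carries over.\<close>

lemma step2_arcs_fixed_port:
  assumes T: "directed_rotational_terrace r T" and "r \<ge> 11" "coprime (int r) 3"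
    and c: "cyclically_contains T [9, 6, 7, 5, 8, 3, 10]"
  obtains t where
    "\<forall>x. (x, 2) \<in> arcs (fixed_port r T j) \<longleftrightarrow> x \<in> {0..<3 * int r} \<and> [x = t] (mod int r)"
proof -
  have "r \<ge> 3" using \<open>r \<ge> 11\<close> by simp
  with T obtain t i where t: "t \<in> {1..<int r}" "t = T ! i" "i < length T" "cyclic_diff r T i = 2"
    and F: "\<forall>x. (x, 2) \<in> arcs (F3 r T) \<longleftrightarrow> x \<in> {0..<3 * int r} \<and> [x = t] (mod int r)"
    by (rule step2_arcs_F3)
  have dist: "distinct T" using T by (simp add: directed_rotational_terrace_def)
  have diff: "cyclic_diff r T i =
      ([9, 6, 7, 5, 8, 3, 10] ! Suc k - [9, 6, 7, 5, 8, 3, 10] ! k) mod int r"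
    if "t = [9, 6, 7, 5, 8, 3, 10] ! k" "k < 6" for k
    using that t by (intro cyclic_diff_contained[OF c dist]) auto
  \<comment> \<open>The indices 0, 1, 5 used below mark the path arcs leaving 9, 6 and 3, with
    differences -3, 1 and 7; for \<open>r \<ge> 11\<close> none is 2 mod \<open>r\<close>.\<close>
  have "(-3) mod int r = int r - 3" using \<open>r \<ge> 11\<close> by (simp add: zmod_zminus1_eq_if)
  then have "t \<noteq> 9" using diff[of 0] t(4) \<open>r \<ge> 11\<close> by auto
  moreover have "t \<noteq> 6" using diff[of 1] t(4) \<open>r \<ge> 11\<close> by auto
  moreover have "t \<noteq> 3" using diff[of 5] t(4) \<open>r \<ge> 11\<close> by (auto simp: nth_Cons')
  moreover have "t \<noteq> 0" using t(1) by simp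
  \<comment> \<open>All of 9, 6, 3, 0 and \<open>t\<close> lie in \<open>{0..<r}\<close>, so
    congruence would mean equality.\<close>
  ultimately have no: "\<not> [y = t] (mod int r)" if "y \<in> {9, 6, 3, 0}" for y
    using that t(1) \<open>r \<ge> 11\<close> by (auto simp: cong_def)
  have "x \<notin> crt_lift r j ` {9, 6, 3, 0}" if "[x = t] (mod int r)" for x
  proof
    assume "x \<in> crt_lift r j ` {9, 6, 3, 0}"
    then obtain y where y: "y \<in> {9, 6, 3, 0}" "x = crt_lift r j y" by blast
    have "[x = y] (mod int r)"
      unfolding y(2) using crt_lift_cong[OF \<open>coprime (int r) 3\<close>] \<open>r \<ge> 11\<close> by simp
    then have "[y = t] (mod int r)" using that cong_sym cong_trans by blast
    then show False using no y(1) by blast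
  qed
  \<comment> \<open>Restricting to step 2 discards the four inserted arcs, whose steps are 1,
    \<open>r\<close>, \<open>r - 3\<close> and 7.\<close>
  moreover have "arcs (fixed_port r T j) \<inter> UNIV \<times> {2} =
      {a \<in> arcs (F3 r T). fst a \<notin> crt_lift r j ` {9, 6, 3, 0}} \<inter> UNIV \<times> {2}"
    using \<open>r \<ge> 11\<close> by (auto simp: fixed_port_def F3_def C3_def)
  then have "(x, 2) \<in> arcs (fixed_port r T j) \<longleftrightarrow>
      (x, 2) \<in> arcs (F3 r T) \<and> x \<notin> crt_lift r j ` {9, 6, 3, 0}" for x
    by (auto simp: set_eq_iff)
  ultimately show thesis using F by (intro that[of t]) blast
qed

text \<open>The path ends at \<open>2 * r < 3 * r\<close>, so it never wraps around and its vertices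
  are distinct as integers.\<close>

lemma apath_even_path:
  assumes "r \<ge> 2"
  shows "pre_digraph.apath (C3 r) 0 (even_path r) (2 * int r)"
proof -
  interpret pre_digraph "C3 r" .
  \<comment> \<open>The starting index varies so that induction can peel off the first arc,
    following the recursion of \<open>cas\<close>.\<close>
  have "cas (2 * int m) (map (\<lambda>i. (2 * int i, 2)) [m..<n]) (2 * int n)"
    if "m \<le> n" "n \<le> r" for m n
    using that
  proof (induction "n - m" arbitrary: m)
    case 0
    then show ?case by simp
  next
    case (Suc d)
    then have "m < n" by simp
    with Suc.prems assms have "(2 * int m + 2) mod (3 * int r) = 2 * int (Suc m)" by simp
    moreover have "cas (2 * int (Suc m)) (map (\<lambda>i. (2 * int i, 2)) [Suc m..<n]) (2 * int n)"
      using Suc.hyps(1)[of "Suc m"] Suc.hyps(2) Suc.prems \<open>m < n\<close> by simp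
    moreover have "tail (C3 r) = fst" "head (C3 r) = (\<lambda>(x, s). (x + s) mod (3 * int r))"
      by (simp_all add: C3_def)
    ultimately show ?case
      using \<open>m < n\<close> by (simp add: upt_conv_Cons add.commute del: upt_Suc)
  qed
  from this[of 0 r] have "cas 0 (even_path r) (2 * int r)" by (simp add: even_path_def)
  moreover have "set (even_path r) \<subseteq> arcs (C3 r)"
    using assms by (auto simp: even_path_def C3_def)
  moreover have "distinct (awalk_verts 0 (even_path r))"
    using assms by (simp add: awalk_verts_even_path distinct_map inj_on_def del: upt_Suc)
  ultimately show ?thesis
    using assms by (simp add: apath_def awalk_def) (simp add: C3_def)
qed

text \<open>Reduction mod \<open>3 * r\<close> preserves residues mod \<open>r\<close>, so
  translation by \<open>c\<close> carries the class of \<open>t\<close> onto that of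
  \<open>t + c\<close>; the preimage of \<open>y\<close> is \<open>y - c\<close>.\<close>

lemma mem_arcs_translate_step2:
  assumes H: "\<And>x. (x, 2) \<in> arcs H \<longleftrightarrow> x \<in> {0..<3 * int r} \<and> [x = t] (mod int r)"
    and y: "y \<in> {0..<3 * int r}"
  shows "(y, 2) \<in> arcs (translate r H c) \<longleftrightarrow> [y = t + c] (mod int r)"
proof -
  have "(y, 2) \<in> arcs (translate r H c) \<longleftrightarrow> (\<exists>x. (x, 2) \<in> arcs H \<and> y = (x + c) mod (3 * int r))"
    by (force simp: translate_def)
  also have "\<dots> \<longleftrightarrow> [y = t + c] (mod int r)"
  proof
    assume "\<exists>x. (x, 2) \<in> arcs H \<and> y = (x + c) mod (3 * int r)"
    then obtain x where x: "[x = t] (mod int r)" "y = (x + c) mod (3 * int r)" using H by blast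
    have "[y = x + c] (mod int r)" unfolding x(2) by (simp add: cong_def mod_mod_cancel)
    also have "[x + c = t + c] (mod int r)" using x(1) by (simp add: cong_add)
    finally show "[y = t + c] (mod int r)" .
  next
    assume a: "[y = t + c] (mod int r)"
    let ?x = "(y - c) mod (3 * int r)"
    have "[?x = t] (mod int r)"
      using a cong_diff[OF a cong_refl[of c]] by (simp add: cong_def mod_mod_cancel)
    then have "(?x, 2) \<in> arcs H" using H y by simp
    moreover have "y = (?x + c) mod (3 * int r)" using y by (simp add: mod_add_left_eq)
    ultimately show "\<exists>x. (x, 2) \<in> arcs H \<and> y = (x + c) mod (3 * int r)" by blast
  qed
  finally show ?thesis .
qed

text \<open>For odd \<open>r\<close>, 2 is invertible mod \<open>r\<close>, so doubling permutes the
  residues.\<close>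

lemma double_cong_unique:
  assumes "odd r"
  shows "\<exists>!i. i < r \<and> [2 * int i = z] (mod int r)"
proof -
  have cop: "coprime 2 (int r)" using assms by simp
  have pos: "r > 0" using assms by (cases r) auto
  obtain w where w: "[2 * w = z] (mod int r)"
    using cop by (metis cong_solve_coprime_int cong_scalar_right mult.assoc mult_1)
  let ?i = "nat (w mod int r)"
  have i: "int ?i = w mod int r" using pos by simp
  have "?i < r" using pos by (simp add: nat_less_iff)
  moreover have "[2 * int ?i = z] (mod int r)"
    using w unfolding i by (simp add: cong_def mod_mult_right_eq)
  moreover have "i = i'" if "i < r" "i' < r" "[2 * int i = z] (mod int r)" "[2 * int i' = z] (mod int r)"
    for i i'
  proof -
    have "[2 * int i = 2 * int i'] (mod int r)" using that cong_sym cong_trans by blast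
    then have "[int i = int i'] (mod int r)" using cop by (simp add: cong_mult_lcancel)
    then show ?thesis using that by (simp add: cong_def)
  qed
  ultimately show ?thesis by blast
qed

text \<open>Every arc of the path has step 2, so lying in a given translate becomes a linear
  congruence for its index.\<close>

lemma compatible_deletion_chain_even_path:
  assumes "odd r" "r \<ge> 2"
    and H: "\<And>x. (x, 2) \<in> arcs H \<longleftrightarrow> x \<in> {0..<3 * int r} \<and> [x = t] (mod int r)"
  shows "compatible_deletion_chain r H (even_path r)"
  unfolding compatible_deletion_chain_def
proof (intro conjI ballI exI)
  show "pre_digraph.apath (C3 r) 0 (even_path r) (2 * int r)"
    using assms(2) by (rule apath_even_path)
  show "length (even_path r) = r" by (simp add: even_path_def)
next
  fix k
  have mem: "(2 * int i, 2) \<in> arcs (translate r H (3 * k)) \<longleftrightarrow> [2 * int i = t + 3 * k] (mod int r)"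
    if "i < r" for i
    using that by (intro mem_arcs_translate_step2[OF H]) auto
  have set: "set (even_path r) = (\<lambda>i. (2 * int i, 2)) ` {..<r}"
    by (auto simp: even_path_def)
  obtain i where i: "i < r" "[2 * int i = t + 3 * k] (mod int r)"
    and uniq: "\<And>i'. i' < r \<Longrightarrow> [2 * int i' = t + 3 * k] (mod int r) \<Longrightarrow> i' = i"
    using double_cong_unique[OF assms(1), of "t + 3 * k"] by blast
  show "\<exists>!a. a \<in> set (even_path r) \<and> a \<in> arcs (translate r H (3 * k))"
  proof (rule ex1I[of _ "(2 * int i, 2)"])
    show "(2 * int i, 2) \<in> set (even_path r) \<and> (2 * int i, 2) \<in> arcs (translate r H (3 * k))"
      using i mem set by blast
    fix a assume a: "a \<in> set (even_path r) \<and> a \<in> arcs (translate r H (3 * k))"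
    then obtain i' where "i' < r" "a = (2 * int i', 2)" using set by blast
    with a mem uniq show "a = (2 * int i, 2)" by blast
  qed
qed

theorem proposition7p2:
  fixes r :: nat and T :: "int list" and j :: int
  assumes "r mod 6 = 5" and "r \<ge> 11"
    and "directed_rotational_terrace r T"
    and "cyclically_contains T [9, 6, 7, 5, 8, 3, 10]"
    and "j \<in> {0..<3}"
    and "balanced_hamilton_starter r (fixed_port r T j)"
  shows "chain_compatible r (fixed_port r T j) \<and>
         compatible_deletion_chain r (fixed_port r T j) (even_path r)"
proof -
  \<comment> \<open>The residue 5 mod 6 serves twice: oddness allows halving mod \<open>r\<close>,
    and coprimality to 3 makes \<open>crt_lift\<close> well defined.\<close>
  have "odd r" using assms(1) by presburger
  have "\<not> 3 dvd r" using assms(1) by presburger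
  then have "coprime 3 r" by (intro prime_imp_coprime) auto
  then have "coprime (int r) 3"
    by (metis coprime_commute coprime_int_iff of_nat_numeral)
  obtain t where
    "\<forall>x. (x, 2) \<in> arcs (fixed_port r T j) \<longleftrightarrow> x \<in> {0..<3 * int r} \<and> [x = t] (mod int r)"
    by (rule step2_arcs_fixed_port[OF assms(3,2) \<open>coprime (int r) 3\<close> assms(4)])
  with \<open>odd r\<close> \<open>r \<ge> 11\<close> have "compatible_deletion_chain r (fixed_port r T j) (even_path r)"
    by (intro compatible_deletion_chain_even_path) auto
  then show ?thesis by (auto simp: chain_compatible_def)
qed

end
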